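(* For every $3$-edge-connected graph $G$, the Frank number satisfies $F(G)\le 5$. That is, there exist five strongly connected orientations $O_1,\dots,O_5$ of $G$ such that for every edge $e$ of $G$ there is some $i\in\{1,\dots,5\}$ for which the arc of $O_i$ corresponding to $e$ is deletable in $O_i$.
   Context: Graphs are finite, without loops or multiple edges. An orientation of a graph $G=(V,E)$ is a directed graph obtained by replacing each edge $uv$ by exactly one of the arcs $(u,v)$ or $(v,u)$. A directed graph is strongly connected if for any two vertices $x,y$ there is a directed path from $x$ to $y$. In an orientation $O$ of $G$, an arc $e$ is deletable if $O-e$ (the orientation with arc $e$ removed) is strongly connected. For a $3$-edge-connected graph $G$, the Frank number $F(G)$ is the minimum $k$ such that $G$ admits $k$ strongly connected orientations with the property that for every edge $e$ of $G$ the corresponding arc is deletable in at least one of the $k$ orientations. *)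

theory Defs
  imports "Graph_Theory.Digraph_Component" "HOL-Library.Extended_Nat"
begin

text \<open>
  A finite simple graph is a \<^locale>\<open>pair_graph\<close>: an edge $uv$ is represented by the two opposite
  arcs $(u,v)$ and $(v,u)$, so the edges proper are the two-element sets of end vertices.
\<close>

definition ends :: "'a \<times> 'a \<Rightarrow> 'a set" where
  "ends a = {fst a, snd a}"

definition edges :: "'a pair_pre_digraph \<Rightarrow> 'a set set" where
  "edges G = ends ` parcs G"

definition del_edges :: "'a pair_pre_digraph \<Rightarrow> 'a set set \<Rightarrow> 'a pair_pre_digraph" where
  "del_edges G F = \<lparr>pverts = pverts G, parcs = {a \<in> parcs G. ends a \<notin> F}\<rparr>"

text \<open>
  The one-vertex graph counts as \<open>k\<close>-edge-connected for every \<open>k\<close>; the null graph does not for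
  \<open>k > 0\<close>, since \<^const>\<open>connected\<close> requires a vertex.
\<close>

definition k_edge_connected :: "nat \<Rightarrow> 'a pair_pre_digraph \<Rightarrow> bool" where
  "k_edge_connected k G \<longleftrightarrow>
     (\<forall>F \<subseteq> edges G. card F < k \<longrightarrow> connected (with_proj (del_edges G F)))"

definition orientation :: "'a pair_pre_digraph \<Rightarrow> 'a pair_pre_digraph \<Rightarrow> bool" where
  "orientation G D \<longleftrightarrow> pverts D = pverts G \<and> parcs D \<subseteq> parcs G \<and>
     (\<forall>u v. (u, v) \<in> parcs G \<longrightarrow> ((u, v) \<in> parcs D) \<noteq> ((v, u) \<in> parcs D))"

definition deletable :: "'a pair_pre_digraph \<Rightarrow> 'a \<times> 'a \<Rightarrow> bool" where
  "deletable D a \<longleftrightarrow> a \<in> parcs D \<and> strongly_connected (pre_digraph.del_arc (with_proj D) a)"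

lemma orientation_unique_arc:
  assumes "pair_graph G" "orientation G D" "e \<in> edges G"
  shows "\<exists>!a. a \<in> parcs D \<and> ends a = e"
proof -
  interpret pair_graph G by fact
  have s: "(v, u) \<in> parcs G" if "(u, v) \<in> parcs G" for u v
    using pair_sym_arcs that by (auto simp: symmetric_def dest: symD)
  obtain u v where uv: "(u, v) \<in> parcs G" "e = {u, v}"
    using assms(3) by (auto simp: edges_def ends_def)
  have x: "((u, v) \<in> parcs D) \<noteq> ((v, u) \<in> parcs D)"
    using assms(2) uv by (auto simp: orientation_def)
  have "a = (u, v) \<or> a = (v, u)" if "ends a = e" for a
    using that uv(2) by (cases a) (auto simp: ends_def doubleton_eq_iff)
  moreover have "ends (u, v) = e" "ends (v, u) = e"
    using uv(2) by (auto simp: ends_def)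
  ultimately show ?thesis using x by metis
qed

text \<open>
  The orientations form a family indexed by $1, \dots, k$, possibly with repetitions. The infimum
  is taken in \<^typ>\<open>enat\<close>, so that it is \<open>\<infinity>\<close> rather than \<open>0\<close> if no such family exists.
\<close>

definition frank_number :: "'a pair_pre_digraph \<Rightarrow> enat" where
  "frank_number G = Inf {enat k | k. \<exists>D :: nat \<Rightarrow> 'a pair_pre_digraph.
     (\<forall>i \<in> {1..k}. orientation G (D i) \<and> strongly_connected (with_proj (D i))) \<and>
     (\<forall>e \<in> edges G. \<exists>i \<in> {1..k}. \<exists>a \<in> parcs (D i). ends a = e \<and> deletable (D i) a)}"

end

theory Submission
  imports Defs "HOL-Library.Transitive_Closure_Table"
begin

text \<open>
  Let \<open>f\<close> be a nowhere-zero integer flow on a 3-edge-connected graph, and orient every edge so that its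
  value is positive. Every cut is crossed by the same amount of flow in both directions, so the
  orientation is strongly connected, and an arc of value 1 is deletable: were it alone in its
  direction across a cut, one unit would have to return along at least two edges. Hence it suffices
  to find five nowhere-zero flows such that every edge has value \<open>\<plusminus>1\<close> in one of them.

  As in Jaeger's 8-flow theorem, the edges are covered by three even subgraphs. The first one, \<open>C\<close>, is
  found as in Seymour's proof of the 6-flow theorem: starting from one vertex, repeatedly attach
  a connected even subgraph by two edges to what has been built. Contracting \<open>C\<close> then leaves a graph
  with two edge-disjoint spanning trees, and the complement of each is contained in an even subgraph
  up to edges of \<open>C\<close>.

  Every mod-2 sum of these three even subgraphs carries a flow with values \<open>\<plusminus>1\<close>, and the five flows are
  combinations with coefficients 1, 2, 4 of three such flows for suitable linearly independent sums.

  Even subgraphs are represented throughout by the arcs on which a skew-symmetric integer function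
  is odd, so that symmetric differences become sums.
\<close>

section \<open>Skew-symmetric chains\<close>

text \<open>An edge occurs as two opposite arcs; skew symmetry lets it carry one signed value
  without fixing a reference orientation.\<close>

definition skew :: "('a \<Rightarrow> 'a \<Rightarrow> int) \<Rightarrow> bool" where
  "skew g \<longleftrightarrow> (\<forall>u v. g u v = - g v u)"

text \<open>A positive \<open>g v u\<close> is read as flow from \<open>v\<close> to
  \<open>u\<close>, so this is outflow minus inflow.\<close>

definition net :: "'a set \<Rightarrow> ('a \<Rightarrow> 'a \<Rightarrow> int) \<Rightarrow> 'a \<Rightarrow> int" where
  "net V g v = (\<Sum>u\<in>V. g v u)"

definition unit_chain :: "'a \<Rightarrow> 'a \<Rightarrow> 'a \<Rightarrow> 'a \<Rightarrow> int" where
  "unit_chain a b u v = of_bool (u = a \<and> v = b) - of_bool (u = b \<and> v = a)"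

definition circulation :: "'a set \<Rightarrow> ('a \<times> 'a) set \<Rightarrow> ('a \<Rightarrow> 'a \<Rightarrow> int) \<Rightarrow> bool" where
  "circulation V A f \<longleftrightarrow>
     skew f \<and> (\<forall>u v. f u v \<noteq> 0 \<longrightarrow> (u, v) \<in> A) \<and> (\<forall>v\<in>V. net V f v = 0)"

lemma skewD: "skew g \<Longrightarrow> g u v = - g v u"
  unfolding skew_def by blast

lemma net_linear: "net V (\<lambda>u v. a * f u v + b * g u v) w = a * net V f w + b * net V g w"
  by (simp add: net_def sum.distrib sum_distrib_left)

lemma skew_linear: "skew f \<Longrightarrow> skew g \<Longrightarrow> skew (\<lambda>u v. a * f u v + b * g u v)"
  unfolding skew_def by (metis add.inverse_distrib_swap add.commute mult_minus_right)

lemma circulation_linear: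
  assumes "circulation V A f" "circulation V A g"
  shows "circulation V A (\<lambda>u v. a * f u v + b * g u v)"
proof -
  have "(u, v) \<in> A" if "a * f u v + b * g u v \<noteq> 0" for u v
    using assms that unfolding circulation_def by (cases "f u v = 0") auto
  then show ?thesis
    using assms by (auto simp: circulation_def net_linear skew_linear)
qed

lemma skew_zero: "skew (\<lambda>_ _. 0)"
  by (simp add: skew_def)

lemma skew_unit_chain: "skew (unit_chain a b)"
  unfolding skew_def unit_chain_def by (simp add: conj_commute)

lemma net_unit_chain:
  assumes "finite V" "a \<in> V" "b \<in> V"
  shows "net V (unit_chain a b) v = of_bool (v = a) - of_bool (v = b)"
proof -
  have "net V (unit_chain a b) v =
    (\<Sum>u\<in>V. if u = b then of_bool (v = a) else 0) - (\<Sum>u\<in>V. if u = a then of_bool (v = b) else 0)"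
    unfolding net_def unit_chain_def sum_subtractf[symmetric] by (intro sum.cong) auto
  then show ?thesis
    using assms by simp
qed

text \<open>Arcs inside \<open>R\<close> cancel in opposite pairs, so only the cut remains. The flow
  arguments across cuts below rest on this.\<close>

lemma sum_net_eq_outflow:
  assumes "finite V" "skew g" "R \<subseteq> V"
  shows "(\<Sum>v\<in>R. net V g v) = (\<Sum>(u, v)\<in>R \<times> (V - R). g u v)"
proof -
  have "(\<Sum>v\<in>R. \<Sum>u\<in>R. g v u) = (\<Sum>v\<in>R. \<Sum>u\<in>R. g u v)"
    by (rule sum.swap)
  also have "\<dots> = - (\<Sum>v\<in>R. \<Sum>u\<in>R. g v u)"
    by (simp add: sum_negf[symmetric] skewD[OF \<open>skew g\<close>, symmetric])
  finally have inner: "(\<Sum>v\<in>R. \<Sum>u\<in>R. g v u) = 0" by simp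
  have "(\<Sum>v\<in>R. net V g v) = (\<Sum>v\<in>R. (\<Sum>u\<in>R. g v u) + (\<Sum>u\<in>V - R. g v u))"
    unfolding net_def using assms by (intro sum.cong refl sum.subset_diff[THEN trans]) auto
  then show ?thesis
    by (simp add: sum.distrib inner flip: sum.cartesian_product)
qed

lemma sum_net_restrict:
  assumes "finite V" "skew g" "R \<subseteq> V"
    and "\<And>u v. u \<in> R \<Longrightarrow> v \<in> V - R \<Longrightarrow> g u v \<noteq> 0 \<Longrightarrow> (u, v) \<in> A"
  shows "(\<Sum>v\<in>R. net V g v) = (\<Sum>(u, v)\<in>A \<inter> R \<times> (V - R). g u v)"
proof -
  have "finite (R \<times> (V - R))"
    using assms finite_subset[of R V] by auto
  then show ?thesis
    unfolding sum_net_eq_outflow[OF assms(1-3)]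
    by (intro sum.mono_neutral_right) (use assms(4) in auto)
qed

section \<open>Chains along paths and reduction of values to -1, 0, 1\<close>

text \<open>Induction prepends the unit chain of the first step. Distinctness keeps \<open>x\<close>
  off the support of the rest, so values do not pile up; the support clause serves this
  step.\<close>

lemma path_chain_aux:
  assumes "rtrancl_path r x xs y" "distinct (x # xs)"
  shows "\<exists>p. skew p \<and> (\<forall>u v. \<bar>p u v\<bar> \<le> 1) \<and> (\<forall>u v. p u v > 0 \<longrightarrow> r u v) \<and>
    (\<forall>u v. p u v \<noteq> 0 \<longrightarrow> u \<in> set (x # xs) \<and> v \<in> set (x # xs)) \<and>
    (\<forall>V v. finite V \<longrightarrow> (\<forall>u v. r u v \<longrightarrow> u \<in> V \<and> v \<in> V) \<longrightarrow>
       net V p v = of_bool (v = x) - of_bool (v = y))"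
  using assms
proof (induction rule: rtrancl_path.induct)
  case (base x)
  show ?case
    by (rule exI[of _ "\<lambda>_ _. 0"]) (auto simp: skew_def net_def)
next
  case (step x z zs y)
  then obtain p where p: "skew p" "\<And>u v. \<bar>p u v\<bar> \<le> 1" "\<And>u v. p u v > 0 \<Longrightarrow> r u v"
    "\<And>u v. p u v \<noteq> 0 \<Longrightarrow> u \<in> set (z # zs) \<and> v \<in> set (z # zs)"
    "\<And>V v. finite V \<Longrightarrow> \<forall>u v. r u v \<longrightarrow> u \<in> V \<and> v \<in> V \<Longrightarrow>
       net V p v = of_bool (v = z) - of_bool (v = y)"
    by auto
  define q where "q = (\<lambda>u v. 1 * unit_chain x z u v + 1 * p u v)"
  have x: "p x v = 0" "p v x = 0" for v
    using p(4)[of x v] p(4)[of v x] step.prems by auto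
  have xz: "x \<noteq> z" using step.prems by auto
  have q: "q u v = (if u = x \<and> v = z then 1 else if u = z \<and> v = x then - 1 else p u v)" for u v
    using x xz by (auto simp: q_def unit_chain_def)
  have "skew q"
    unfolding q_def by (intro skew_linear skew_unit_chain p)
  moreover have "net V q v = of_bool (v = x) - of_bool (v = y)"
    if "finite V" "\<forall>u v. r u v \<longrightarrow> u \<in> V \<and> v \<in> V" for V v
    unfolding q_def net_linear p(5)[OF that]
    using net_unit_chain[OF that(1), of x z v] that step.hyps by auto
  moreover have "\<forall>u v. \<bar>q u v\<bar> \<le> 1" "\<forall>u v. q u v > 0 \<longrightarrow> r u v"
    using p(2,3) step.hyps by (auto simp: q)
  moreover have "\<forall>u v. q u v \<noteq> 0 \<longrightarrow> u \<in> set (x # z # zs) \<and> v \<in> set (x # z # zs)"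
    using p(4) by (auto simp: q)
  ultimately show ?case by blast
qed

lemma path_chain:
  assumes "r\<^sup>*\<^sup>* x y" "finite V" "\<And>u v. r u v \<Longrightarrow> u \<in> V \<and> v \<in> V"
  obtains p where "skew p" "\<And>u v. \<bar>p u v\<bar> \<le> 1" "\<And>u v. p u v > 0 \<Longrightarrow> r u v"
    "\<And>v. net V p v = of_bool (v = x) - of_bool (v = y)"
proof -
  obtain xs where "rtrancl_path r x xs y"
    using assms(1) by (auto simp: rtranclp_eq_rtrancl_path)
  then obtain ys where "rtrancl_path r x ys y" "distinct (x # ys)"
    by (rule rtrancl_path_distinct)
  from path_chain_aux[OF this] obtain p where "skew p" "\<forall>u v. \<bar>p u v\<bar> \<le> 1"
    "\<forall>u v. p u v > 0 \<longrightarrow> r u v"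
    and "\<forall>V v. finite V \<longrightarrow> (\<forall>u v. r u v \<longrightarrow> u \<in> V \<and> v \<in> V) \<longrightarrow>
       net V p v = of_bool (v = x) - of_bool (v = y)"
    by (elim exE conjE)
  moreover from this(4) have "net V p v = of_bool (v = x) - of_bool (v = y)" for v
    using assms(2,3) by simp
  ultimately show ?thesis
    using that[of p] by simp
qed

text \<open>
  Among the chains with values in \<open>{-1, 0, 1}\<close> and the given parities, one of least total imbalance
  is a circulation: otherwise reversing a path from a source to a sink would decrease the imbalance.
\<close>

lemma circulation_of_even_net:
  assumes V: "finite V" and g: "skew g" "\<And>u v. g u v \<noteq> 0 \<Longrightarrow> (u, v) \<in> A" and A: "A \<subseteq> V \<times> V"
    and ev: "\<And>v. v \<in> V \<Longrightarrow> even (net V g v)"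
  obtains f where "circulation V A f" "\<And>u v. \<bar>f u v\<bar> \<le> 1" "\<And>u v. even (f u v) = even (g u v)"
proof -
  define P where "P h \<longleftrightarrow> skew h \<and> (\<forall>u v. \<bar>h u v\<bar> \<le> 1) \<and> (\<forall>u v. even (h u v) = even (g u v))" for h
  define m where "m h = nat (\<Sum>v\<in>V. \<bar>net V h v\<bar>)" for h
  have "\<bar>if odd k then sgn k else 0\<bar> \<le> 1" "even (if odd k then sgn k else 0) = even k" for k :: int
    by (auto simp: sgn_if)
  moreover have "skew (\<lambda>u v. if odd (g u v) then sgn (g u v) else 0)"
    unfolding skew_def by (intro allI, subst (1 2) skewD[OF g(1)]) simp
  \<comment> \<open>Replacing odd values by their signs and even ones by 0 gives a first candidate,
    so a least one exists.\<close>
  ultimately have "P (\<lambda>u v. if odd (g u v) then sgn (g u v) else 0)"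
    unfolding P_def by (intro conjI allI) assumption+
  from ex_has_least_nat[of P, OF this, of m]
  obtain h where h: "P h" and min: "\<And>h'. P h' \<Longrightarrow> m h \<le> m h'"
    by (elim exE conjE) auto
  have hv: "skew h" "\<bar>h u v\<bar> \<le> 1" "even (h u v) = even (g u v)" for u v
    using h by (auto simp: P_def)
  have hA: "(u, v) \<in> A" if "h u v \<noteq> 0" for u v
  proof -
    have "odd (h u v)" using hv(2)[of u v] that by (cases "h u v = 1"; cases "h u v = -1"; force)
    then have "g u v \<noteq> 0" using hv(3)[of u v] by auto
    then show ?thesis using g(2) by blast
  qed
  have hev: "even (net V h v)" if "v \<in> V" for v
  proof -
    have "even (net V h v) = even (net V g v)"
      unfolding net_def using V by (induction V rule: finite_induct) (auto simp: hv)
    then show ?thesis using ev that by simp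
  qed
  have tot: "(\<Sum>v\<in>V. net V h v) = 0"
    using sum_net_eq_outflow[OF V hv(1), of V] by simp
  have "net V h v = 0" if "v \<in> V" for v
  proof (rule ccontr)
    assume "net V h v \<noteq> 0"
    have "\<exists>x\<in>V. net V h x > 0"
    proof (rule ccontr)
      assume *: "\<not> ?thesis"
      then have "\<forall>x\<in>V. net V h x = 0"
        using sum_nonneg_eq_0_iff[OF V, of "\<lambda>x. - net V h x"] tot by (auto simp: sum_negf not_less)
      with \<open>net V h v \<noteq> 0\<close> that show False by blast
    qed
    then obtain x where x: "x \<in> V" "net V h x > 0" by blast
    define r where "r u v \<longleftrightarrow> h u v = 1" for u v
    have rV: "u \<in> V \<and> v \<in> V" if "r u v" for u v
      using hA[of u v] that A by (auto simp: r_def)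
    \<comment> \<open>No arc of value 1 leaves \<open>R\<close>, so its total net value is at most
      0; as \<open>x\<close> is a source, \<open>R\<close> also contains a sink.\<close>
    define R where "R = {v. r\<^sup>*\<^sup>* x v}"
    have RV: "R \<subseteq> V"
    proof
      fix v assume "v \<in> R"
      then have "r\<^sup>*\<^sup>* x v" by (simp add: R_def)
      then show "v \<in> V" by (cases rule: rtranclp.cases) (use x rV in auto)
    qed
    have "h u v \<le> 0" if "u \<in> R" "v \<in> V - R" for u v
    proof -
      have "\<not> r u v" using that rtranclp.rtrancl_into_rtrancl[of r x u v] by (auto simp: R_def)
      then show ?thesis using hv(2)[of u v] by (auto simp: r_def)
    qed
    then have "(\<Sum>v\<in>R. net V h v) \<le> 0"
      unfolding sum_net_eq_outflow[OF V hv(1) RV] by (intro sum_nonpos) auto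
    have "\<exists>y\<in>R. net V h y < 0"
    proof (rule ccontr)
      assume "\<not> ?thesis"
      then have "\<forall>y\<in>R. net V h y \<ge> 0" by auto
      moreover have "x \<in> R" by (simp add: R_def)
      ultimately have "(\<Sum>v\<in>R. net V h v) > 0"
        using x(2) finite_subset[OF RV V] by (meson sum_pos2)
      with \<open>(\<Sum>v\<in>R. net V h v) \<le> 0\<close> show False by simp
    qed
    then obtain y where y: "y \<in> R" "net V h y < 0" by blast
    have xy: "x \<noteq> y" "y \<in> V" using x y RV by auto
    obtain p where p: "skew p" "\<And>u v. \<bar>p u v\<bar> \<le> 1" "\<And>u v. p u v > 0 \<Longrightarrow> r u v"
      "\<And>v. net V p v = of_bool (v = x) - of_bool (v = y)"
      using path_chain[of r x y V] y V rV by (auto simp: R_def)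
    \<comment> \<open>Subtracting \<open>2 * p\<close> flips the values 1 along the path to -1,
      which keeps both the bound and the parities.\<close>
    define h' where "h' = (\<lambda>u v. 1 * h u v + (-2) * p u v)"
    have "\<bar>h' u v\<bar> \<le> 1" for u v
    proof -
      have "p u v > 0 \<Longrightarrow> h u v = 1" "p v u > 0 \<Longrightarrow> h v u = 1"
        using p(3) by (auto simp: r_def)
      then show ?thesis
        using hv(2)[of u v] p(2)[of u v] skewD[OF p(1), of u v] skewD[OF hv(1), of u v]
        unfolding h'_def by linarith
    qed
    then have "P h'"
      unfolding P_def using hv by (auto simp: h'_def intro: skew_linear[OF hv(1) p(1), of 1 "-2", simplified])
    have net': "net V h' v = net V h v - 2 * (of_bool (v = x) - of_bool (v = y))" for v
      unfolding h'_def net_linear p(4) by simp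
    \<comment> \<open>Evenness matters here: the imbalances at \<open>x\<close> and \<open>y\<close>
      are at least 2 in absolute value, so moving each by 2 does not overshoot 0.\<close>
    have "net V h x \<ge> 2" "net V h y \<le> - 2"
      using hev[OF x(1)] hev[OF xy(2)] x(2) y(2) by presburger+
    then have "(\<Sum>v\<in>V. \<bar>net V h' v\<bar>) < (\<Sum>v\<in>V. \<bar>net V h v\<bar>)"
      using V x xy by (intro sum_strict_mono_ex1) (auto simp: net')
    then have "m h' < m h"
      using sum_nonneg[of V "\<lambda>v. \<bar>net V h' v\<bar>"] unfolding m_def by linarith
    with min[OF \<open>P h'\<close>] show False by simp
  qed
  then have "circulation V A h"
    using hv hA by (auto simp: circulation_def)
  with hv that show ?thesis by blast
qed

lemma net_superset:
  assumes "finite W" "V \<subseteq> W" "\<And>u v. g u v \<noteq> 0 \<Longrightarrow> v \<in> V"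
  shows "net W g w = net V g w"
  unfolding net_def using assms by (intro sum.mono_neutral_right) auto

section \<open>Covering the edges by three even subgraphs\<close>

definition odd_arcs :: "('a \<Rightarrow> 'a \<Rightarrow> int) \<Rightarrow> ('a \<times> 'a) set" where
  "odd_arcs g = {(u, v). odd (g u v)}"

lemma sym_odd_arcs:
  assumes "skew g"
  shows "sym (odd_arcs g)"
proof (rule symI)
  show "(v, u) \<in> odd_arcs g" if "(u, v) \<in> odd_arcs g" for u v
    using that skewD[OF assms, of u v] by (simp add: odd_arcs_def)
qed

text \<open>From \<open>a\<close> one crosses to \<open>z\<close>, returns by symmetry to the root
  \<open>x\<close> of \<open>K\<close>, and reaches all of \<open>K\<close> from there. The
  attaching vertex \<open>z\<close> may differ from the root.\<close>

lemma connected_extend: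
  assumes "sym Q" "\<And>u v. u \<in> H \<Longrightarrow> v \<in> H \<Longrightarrow> (u, v) \<in> Q\<^sup>*" "\<And>v. v \<in> K \<Longrightarrow> (x, v) \<in> Q\<^sup>*"
    and "z \<in> K" "a \<in> H" "(z, a) \<in> Q" "u \<in> H \<union> K" "v \<in> H \<union> K"
  shows "(u, v) \<in> Q\<^sup>*"
proof -
  have sym: "(w, w') \<in> Q\<^sup>*" if "(w', w) \<in> Q\<^sup>*" for w w'
    using that sym_rtrancl[OF assms(1)] by (meson symE)
  have "(a, w) \<in> Q\<^sup>*" if "w \<in> H \<union> K" for w
  proof (cases "w \<in> H")
    case False
    then have "(x, w) \<in> Q\<^sup>*" using assms(3) that by blast
    moreover have "(z, x) \<in> Q\<^sup>*" using assms(3,4) sym by blast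
    moreover have "(a, z) \<in> Q\<^sup>*" using assms(6) sym by blast
    ultimately show ?thesis by (meson rtrancl_trans)
  qed (use assms(2,5) in blast)
  then show ?thesis using assms(7,8) sym by (meson rtrancl_trans)
qed

section \<open>Augmenting paths and connected even subgraphs\<close>

text \<open>A graph reduced to its vertex and arc sets, so that the results also apply to the
  subgraph induced on a block \<open>B\<close>.\<close>

locale sym_arcs =
  fixes V :: "'a set" and A :: "('a \<times> 'a) set"
  assumes finite_V: "finite V" and A_subset: "A \<subseteq> V \<times> V" and sym_A: "sym A"
    and no_loop: "(v, v) \<notin> A"
begin

lemma A_flip: "(u, v) \<in> A \<Longrightarrow> (v, u) \<in> A"
  using sym_A by (meson symE)

lemma finite_A: "finite A"
  using finite_V A_subset finite_subset by blast

text \<open>One Ford-Fulkerson step: an arc of value at most 0 can take one more unit, and the cut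
  condition says that no set separating \<open>x\<close> from \<open>y\<close> is saturated.\<close>

lemma augment:
  assumes g: "skew g" "\<And>u v. \<bar>g u v\<bar> \<le> 1" "\<And>u v. g u v \<noteq> 0 \<Longrightarrow> (u, v) \<in> A"
    and xy: "x \<in> V" "y \<in> V"
    and cut: "\<And>R. R \<subseteq> V \<Longrightarrow> x \<in> R \<Longrightarrow> y \<notin> R \<Longrightarrow> \<exists>(u, v)\<in>A \<inter> R \<times> (V - R). g u v \<le> 0"
  obtains g' where "skew g'" "\<And>u v. \<bar>g' u v\<bar> \<le> 1" "\<And>u v. g' u v \<noteq> 0 \<Longrightarrow> (u, v) \<in> A"
    "\<And>v. net V g' v = net V g v + (of_bool (v = x) - of_bool (v = y))"
proof -
  define r where "r u v \<longleftrightarrow> (u, v) \<in> A \<and> g u v \<le> 0" for u v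
  have rV: "u \<in> V \<and> v \<in> V" if "r u v" for u v
    using that A_subset by (auto simp: r_def)
  have "r\<^sup>*\<^sup>* x y"
  proof (rule ccontr)
    assume nxy: "\<not> r\<^sup>*\<^sup>* x y"
    define R where "R = {v \<in> V. r\<^sup>*\<^sup>* x v}"
    have "R \<subseteq> V" "x \<in> R" "y \<notin> R"
      using nxy xy by (auto simp: R_def)
    from cut[OF this] obtain u v where "(u, v) \<in> A" "u \<in> R" "v \<in> V - R" "g u v \<le> 0"
      by auto
    then show False
      using rtranclp.rtrancl_into_rtrancl[of r x u v] by (auto simp: R_def r_def)
  qed
  then obtain p where p: "skew p" "\<And>u v. \<bar>p u v\<bar> \<le> 1" "\<And>u v. p u v > 0 \<Longrightarrow> r u v"
    "\<And>v. net V p v = of_bool (v = x) - of_bool (v = y)"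
    using path_chain[of r x y V] finite_V rV by blast
  define g' where "g' = (\<lambda>u v. 1 * g u v + 1 * p u v)"
  show thesis
  proof (rule that[of g'])
    show "skew g'"
      unfolding g'_def by (intro skew_linear g p)
    show "net V g' v = net V g v + (of_bool (v = x) - of_bool (v = y))" for v
      unfolding g'_def net_linear p(4) by simp
    fix u v
    have r: "p u v > 0 \<Longrightarrow> (u, v) \<in> A \<and> g u v \<le> 0" "p v u > 0 \<Longrightarrow> (v, u) \<in> A \<and> g v u \<le> 0"
      using p(3) by (auto simp: r_def)
    have s: "p v u = - p u v" "g v u = - g u v"
      by (rule skewD[OF p(1)], rule skewD[OF g(1)])
    show "\<bar>g' u v\<bar> \<le> 1"
      using r s g(2)[of u v] p(2)[of u v] unfolding g'_def by linarith
    assume "g' u v \<noteq> 0"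
    then have "g u v \<noteq> 0 \<or> p u v > 0 \<or> p v u > 0"
      using s by (auto simp: g'_def)
    then show "(u, v) \<in> A"
      using r g(3) A_flip by blast
  qed
qed

text \<open>This is Menger's theorem for two edge-disjoint paths.\<close>

lemma flow_of_value_two:
  assumes xy: "x \<in> V" "y \<in> V" "x \<noteq> y"
    and cut: "\<And>R. R \<subseteq> V \<Longrightarrow> x \<in> R \<Longrightarrow> y \<notin> R \<Longrightarrow> 2 \<le> card (A \<inter> R \<times> (V - R))"
  obtains g where "skew g" "\<And>u v. \<bar>g u v\<bar> \<le> 1" "\<And>u v. g u v \<noteq> 0 \<Longrightarrow> (u, v) \<in> A"
    "\<And>v. net V g v = 2 * (of_bool (v = x) - of_bool (v = y))"
proof -
  have ex: "\<exists>(u, v)\<in>A \<inter> R \<times> (V - R). (0::int) \<le> 0" if "R \<subseteq> V" "x \<in> R" "y \<notin> R" for R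
  proof -
    have "A \<inter> R \<times> (V - R) \<noteq> {}"
      using cut[OF that] by (metis card.empty not_numeral_le_zero)
    then show ?thesis by fast
  qed
  obtain f where f: "skew f" "\<And>u v. \<bar>f u v\<bar> \<le> 1" "\<And>u v. f u v \<noteq> 0 \<Longrightarrow> (u, v) \<in> A"
    "\<And>v. net V f v = of_bool (v = x) - of_bool (v = y)"
    using augment[OF skew_zero _ _ xy(1,2) ex] by (auto simp: net_def)
  \<comment> \<open>If no residual arc leaves \<open>R\<close>, then \<open>f\<close> is 1 on the
    whole cut, so the cut has as many arcs as \<open>f\<close> has value, namely one.\<close>
  have cut': "\<exists>(u, v)\<in>A \<inter> R \<times> (V - R). f u v \<le> 0" if R: "R \<subseteq> V" "x \<in> R" "y \<notin> R" for R
  proof (rule ccontr)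
    assume *: "\<not> ?thesis"
    have one: "f u v = 1" if "(u, v) \<in> A \<inter> R \<times> (V - R)" for u v
    proof -
      have "f u v > 0" using * bexI[OF _ that, of "\<lambda>(u, v). f u v \<le> 0"] by (cases "f u v \<le> 0") auto
      then show ?thesis using f(2)[of u v] by simp
    qed
    have "(\<Sum>v\<in>R. net V f v) = (\<Sum>(u, v)\<in>A \<inter> R \<times> (V - R). f u v)"
      by (rule sum_net_restrict[OF finite_V f(1) R(1)]) (use f(3) in blast)
    also have "\<dots> = (\<Sum>_\<in>A \<inter> R \<times> (V - R). 1)"
      by (intro sum.cong refl) (use one in force)
    finally have "(\<Sum>v\<in>R. net V f v) = int (card (A \<inter> R \<times> (V - R)))" by simp
    moreover have "(\<Sum>v\<in>R. net V f v) = (\<Sum>v\<in>R. if v = x then 1 else 0)"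
      by (intro sum.cong refl) (use f(4) R in auto)
    moreover have "\<dots> = 1"
      using R finite_subset[OF R(1) finite_V] by simp
    ultimately show False using cut[OF R] by simp
  qed
  obtain g where "skew g" "\<And>u v. \<bar>g u v\<bar> \<le> 1" "\<And>u v. g u v \<noteq> 0 \<Longrightarrow> (u, v) \<in> A"
    "\<And>v. net V g v = net V f v + (of_bool (v = x) - of_bool (v = y))"
    using augment[OF f(1-3) xy(1,2) cut'] by blast
  then show thesis using that[of g] f(4) by simp
qed

text \<open>A flow of value two with values -1, 0, 1 has even net values, so its support is an even
  subgraph. The component \<open>K\<close> of \<open>x\<close> contains \<open>y\<close>: otherwise
  two units would start in \<open>K\<close> and none could leave.\<close>

lemma connected_even_subgraph:
  assumes xy: "x \<in> V" "y \<in> V"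
    and cut: "\<And>R. R \<subseteq> V \<Longrightarrow> x \<in> R \<Longrightarrow> y \<notin> R \<Longrightarrow> 2 \<le> card (A \<inter> R \<times> (V - R))"
  obtains K g where "x \<in> K" "y \<in> K" "K \<subseteq> V" "skew g" "\<And>u v. g u v \<noteq> 0 \<Longrightarrow> (u, v) \<in> A \<inter> K \<times> K"
    "\<And>v. even (net V g v)" "\<And>v. v \<in> K \<Longrightarrow> (x, v) \<in> (odd_arcs g)\<^sup>*"
proof (cases "x = y")
  \<comment> \<open>This case does occur: the two edges attached later may share their end vertex in
    the block.\<close>
  case True
  show thesis
    by (rule that[of "{x}" "\<lambda>_ _. 0"]) (use True xy skew_zero in \<open>auto simp: net_def\<close>)
next
  case False
  obtain g where g: "skew g" "\<And>u v. \<bar>g u v\<bar> \<le> 1" "\<And>u v. g u v \<noteq> 0 \<Longrightarrow> (u, v) \<in> A"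
    "\<And>v. net V g v = 2 * (of_bool (v = x) - of_bool (v = y))"
    using flow_of_value_two[OF xy False cut] by blast
  have odd: "(u, v) \<in> odd_arcs g \<longleftrightarrow> g u v \<noteq> 0" for u v
  proof -
    have "g u v = 1 \<or> g u v = 0 \<or> g u v = - 1" using g(2)[of u v] by linarith
    then show ?thesis by (auto simp: odd_arcs_def)
  qed
  define K where "K = {v \<in> V. (x, v) \<in> (odd_arcs g)\<^sup>*}"
  have K: "K \<subseteq> V" "x \<in> K" using xy by (auto simp: K_def)
  have closed: "v \<in> K" if "u \<in> K" "g u v \<noteq> 0" for u v
  proof -
    have "(u, v) \<in> odd_arcs g" "v \<in> V"
      using that g(3) A_subset odd by auto
    then show ?thesis using that(1) by (auto simp: K_def intro: rtrancl_into_rtrancl)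
  qed
  have "y \<in> K"
  proof (rule ccontr)
    assume "y \<notin> K"
    have "(\<Sum>v\<in>K. net V g v) = 0"
      unfolding sum_net_eq_outflow[OF finite_V g(1) K(1)]
      by (intro sum.neutral) (use closed in auto)
    moreover have "(\<Sum>v\<in>K. net V g v) = (\<Sum>v\<in>K. if v = x then 2 else 0)"
      by (intro sum.cong refl) (use g(4) \<open>y \<notin> K\<close> in auto)
    moreover have "\<dots> = 2"
      using K finite_subset[OF K(1) finite_V] by simp
    ultimately show False by simp
  qed
  define h where "h u v = (if u \<in> K then g u v else 0)" for u v
  have inK: "u \<in> K \<longleftrightarrow> v \<in> K" if "g u v \<noteq> 0" for u v
    using closed[of u v] closed[of v u] that skewD[OF g(1), of u v] by auto
  show thesis
  proof (rule that[of K h])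
    have "h u v = - h v u" for u v
      using inK[of u v] inK[of v u] skewD[OF g(1), of u v] by (auto simp: h_def)
    then show "skew h"
      unfolding skew_def by blast
    show "(u, v) \<in> A \<inter> K \<times> K" if "h u v \<noteq> 0" for u v
      using that closed g(3) by (auto simp: h_def split: if_splits)
    show "even (net V h v)" for v
      using g(4)[of v] by (cases "v \<in> K") (simp_all add: h_def net_def)
    fix v assume "v \<in> K"
    then have "(x, v) \<in> (odd_arcs g)\<^sup>*" by (simp add: K_def)
    then have "(x, v) \<in> (odd_arcs h)\<^sup>* \<and> v \<in> K"
    proof (induction rule: rtrancl_induct)
      case (step v w)
      then have "(v, w) \<in> odd_arcs h" "w \<in> K"
        using closed[of v w] odd[of v w] by (auto simp: odd_arcs_def h_def)
      then show ?case using step.IH by (auto intro: rtrancl_into_rtrancl)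
    qed (simp add: K)
    then show "(x, v) \<in> (odd_arcs h)\<^sup>*" ..
  qed (use K \<open>y \<in> K\<close> in auto)
qed

section \<open>Growing the even subgraph together with two edge-disjoint trees\<close>

lemma card_arcs_flip: "card (A \<inter> X \<times> Y) = card (A \<inter> Y \<times> X)"
proof -
  have "(A \<inter> X \<times> Y)\<inverse> = A \<inter> Y \<times> X"
    using A_flip by auto
  then show ?thesis by (metis card_inverse)
qed

lemma card_arcs_Un_left:
  assumes "X \<inter> Y = {}"
  shows "card (A \<inter> (X \<union> Y) \<times> Z) = card (A \<inter> X \<times> Z) + card (A \<inter> Y \<times> Z)"
proof -
  have "A \<inter> (X \<union> Y) \<times> Z = (A \<inter> X \<times> Z) \<union> (A \<inter> Y \<times> Z)" by auto
  then show ?thesis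
    using assms finite_A by (simp add: card_Un_disjoint disjoint_iff)
qed

lemma card_arcs_Un_right:
  assumes "Y \<inter> Z = {}"
  shows "card (A \<inter> X \<times> (Y \<union> Z)) = card (A \<inter> X \<times> Y) + card (A \<inter> X \<times> Z)"
  using card_arcs_Un_left[OF assms] by (simp only: card_arcs_flip[of X])

text \<open>
  Contracting the odd arcs of \<open>g\<close> turns \<open>T\<^sub>1\<close> and \<open>T\<^sub>2\<close> into edge-disjoint connected spanning subgraphs
  of the graph induced on \<open>H\<close>.
\<close>

definition double_tree where
  "double_tree H g T\<^sub>1 T\<^sub>2 \<longleftrightarrow> skew g \<and> (\<forall>u v. g u v \<noteq> 0 \<longrightarrow> (u, v) \<in> A \<inter> H \<times> H) \<and>
     (\<forall>v. even (net V g v)) \<and> T\<^sub>1 \<subseteq> A \<inter> H \<times> H \<and> T\<^sub>2 \<subseteq> A \<inter> H \<times> H \<and> sym T\<^sub>1 \<and> sym T\<^sub>2 \<and> T\<^sub>1 \<inter> T\<^sub>2 = {} \<and>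
     (\<forall>u\<in>H. \<forall>v\<in>H. (u, v) \<in> (odd_arcs g \<union> T\<^sub>1)\<^sup>* \<and> (u, v) \<in> (odd_arcs g \<union> T\<^sub>2)\<^sup>*)"

text \<open>
  In the graph induced on the complement \<open>W\<close> of \<open>H\<close>, a minimal set \<open>B\<close> joined to the rest by at
  most one edge is 2-edge-connected, and at least two edges of the whole graph join it to \<open>H\<close>.
\<close>

lemma obtain_leaf_block:
  assumes cut3: "\<And>R. R \<subseteq> V \<Longrightarrow> R \<noteq> {} \<Longrightarrow> R \<noteq> V \<Longrightarrow> 3 \<le> card (A \<inter> R \<times> (V - R))"
    and H: "H \<subseteq> V" "H \<noteq> {}" "H \<noteq> V"
  obtains B where "B \<subseteq> V - H" "2 \<le> card (A \<inter> B \<times> H)"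
    "\<And>R. R \<subset> B \<Longrightarrow> R \<noteq> {} \<Longrightarrow> 2 \<le> card (A \<inter> R \<times> (B - R))"
proof -
  define W where "W = V - H"
  define d where "d X = card (A \<inter> X \<times> (W - X))" for X
  define P where "P X \<longleftrightarrow> X \<subseteq> W \<and> X \<noteq> {} \<and> d X \<le> 1" for X
  have "P W"
    using H by (auto simp: P_def d_def W_def)
  from ex_has_least_nat[of P, OF this, of card]
  obtain B where B: "P B" and min: "\<And>X. P X \<Longrightarrow> card B \<le> card X"
    by (elim exE conjE) auto
  have BW: "B \<subseteq> W" "B \<noteq> {}" "d B \<le> 1" using B by (auto simp: P_def)
  have finB: "finite B"
    using BW finite_V finite_subset[of B V] by (auto simp: W_def)
  \<comment> \<open>Of these at least three edges, at most one goes to the rest of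
    \<open>W\<close>.\<close>
  have "3 \<le> card (A \<inter> B \<times> (V - B))"
    by (rule cut3) (use BW H in \<open>auto simp: W_def\<close>)
  moreover have "V - B = H \<union> (W - B)" "H \<inter> (W - B) = {}"
    using BW H by (auto simp: W_def)
  ultimately have "2 \<le> card (A \<inter> B \<times> H)"
    using BW(3) by (simp add: card_arcs_Un_right d_def)
  moreover have "2 \<le> card (A \<inter> R \<times> (B - R))" if R: "R \<subset> B" "R \<noteq> {}" for R
  proof -
    have big: "2 \<le> d X" if "X \<subset> B" "X \<noteq> {}" for X
    proof -
      have "\<not> P X" using min[of X] psubset_card_mono[OF finB that(1)] by auto
      then show ?thesis using that BW by (auto simp: P_def)
    qed
    have eq: "W - R = (B - R) \<union> (W - B)" "W - (B - R) = R \<union> (W - B)" "B = R \<union> (B - R)"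
      using R BW by auto
    have dis: "(B - R) \<inter> (W - B) = {}" "R \<inter> (W - B) = {}" "R \<inter> (B - R) = {}"
      using R by auto
    \<comment> \<open>With \<open>e\<close> edges between \<open>R\<close> and \<open>B - R\<close>,
      the three counts give \<open>d R + d (B - R) = 2 * e + d B\<close>. Minimality of
      \<open>B\<close> makes the left side at least 4, and \<open>d B\<close> is at most 1, so
      \<open>e\<close> is at least 2.\<close>
    have "d R = card (A \<inter> R \<times> (B - R)) + card (A \<inter> R \<times> (W - B))"
      unfolding d_def eq(1) by (rule card_arcs_Un_right[OF dis(1)])
    moreover have "d (B - R) = card (A \<inter> R \<times> (B - R)) + card (A \<inter> (B - R) \<times> (W - B))"
      unfolding d_def eq(2) using card_arcs_Un_right[OF dis(2), of "B - R"] card_arcs_flip[of R "B - R"]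
      by simp
    moreover have "d B = card (A \<inter> R \<times> (W - B)) + card (A \<inter> (B - R) \<times> (W - B))"
      using card_arcs_Un_left[OF dis(3), of "W - B"] eq(3) unfolding d_def by simp
    moreover have "2 \<le> d R" "2 \<le> d (B - R)"
      using big R by auto
    ultimately show ?thesis using BW(3) by linarith
  qed
  ultimately show thesis
    using that[of B] BW(1) by (simp add: W_def)
qed

text \<open>A leaf block contains a connected even subgraph through the ends of two edges to
  \<open>H\<close>. Contracted, it is one new vertex, and each of the two edges joins it to one of
  the trees.\<close>

lemma double_tree_extend:
  assumes cut3: "\<And>R. R \<subseteq> V \<Longrightarrow> R \<noteq> {} \<Longrightarrow> R \<noteq> V \<Longrightarrow> 3 \<le> card (A \<inter> R \<times> (V - R))"
    and H: "H \<subseteq> V" "H \<noteq> {}" "H \<noteq> V" and dt: "double_tree H g T\<^sub>1 T\<^sub>2"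
  shows "\<exists>H' g' T\<^sub>1' T\<^sub>2'. H \<subset> H' \<and> H' \<subseteq> V \<and> double_tree H' g' T\<^sub>1' T\<^sub>2'"
proof -
  obtain B where B: "B \<subseteq> V - H" "2 \<le> card (A \<inter> B \<times> H)"
    "\<And>R. R \<subset> B \<Longrightarrow> R \<noteq> {} \<Longrightarrow> 2 \<le> card (A \<inter> R \<times> (B - R))"
    using obtain_leaf_block[OF cut3 H] by blast
  obtain S where "S \<subseteq> A \<inter> B \<times> H" "card S = 2"
    using obtain_subset_with_card_n[OF B(2)] by metis
  then obtain x a y b where xa: "(x, a) \<in> A" "x \<in> B" "a \<in> H" and yb: "(y, b) \<in> A" "y \<in> B" "b \<in> H"
    and ne: "(x, a) \<noteq> (y, b)"
    by (auto simp: card_2_iff)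
  have BV: "B \<subseteq> V" and BH: "B \<inter> H = {}" using B(1) by auto
  interpret B: sym_arcs B "A \<inter> B \<times> B"
    using finite_subset[OF BV finite_V] A_flip no_loop by unfold_locales (auto intro: symI)
  have cutB: "2 \<le> card (A \<inter> B \<times> B \<inter> R \<times> (B - R))" if "R \<subseteq> B" "x \<in> R" "y \<notin> R" for R
  proof -
    have "A \<inter> B \<times> B \<inter> R \<times> (B - R) = A \<inter> R \<times> (B - R)" using that by auto
    then show ?thesis using B(3)[of R] that yb by auto
  qed
  obtain K h where K: "x \<in> K" "y \<in> K" "K \<subseteq> B"
    and h: "skew h" "\<And>u v. h u v \<noteq> 0 \<Longrightarrow> (u, v) \<in> A \<inter> B \<times> B \<inter> K \<times> K" "\<And>v. even (net B h v)"
      "\<And>v. v \<in> K \<Longrightarrow> (x, v) \<in> (odd_arcs h)\<^sup>*"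
    using B.connected_even_subgraph[OF xa(2) yb(2) cutB] by blast
  have KH: "K \<inter> H = {}" using K BH by auto
  have g: "skew g" "\<And>u v. g u v \<noteq> 0 \<Longrightarrow> (u, v) \<in> A \<inter> H \<times> H" "\<And>v. even (net V g v)"
    and T: "T\<^sub>1 \<subseteq> A \<inter> H \<times> H" "T\<^sub>2 \<subseteq> A \<inter> H \<times> H" "sym T\<^sub>1" "sym T\<^sub>2" "T\<^sub>1 \<inter> T\<^sub>2 = {}"
    and con: "\<And>u v. u \<in> H \<Longrightarrow> v \<in> H \<Longrightarrow> (u, v) \<in> (odd_arcs g \<union> T\<^sub>1)\<^sup>*"
      "\<And>u v. u \<in> H \<Longrightarrow> v \<in> H \<Longrightarrow> (u, v) \<in> (odd_arcs g \<union> T\<^sub>2)\<^sup>*"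
    using dt unfolding double_tree_def by blast+
  define g' where "g' = (\<lambda>u v. 1 * g u v + 1 * h u v)"
  define U\<^sub>1 where "U\<^sub>1 = T\<^sub>1 \<union> {(x, a), (a, x)}"
  define U\<^sub>2 where "U\<^sub>2 = T\<^sub>2 \<union> {(y, b), (b, y)}"
  have skew': "skew g'"
    unfolding g'_def by (intro skew_linear g h)
  have supp': "(u, v) \<in> A \<inter> (H \<union> K) \<times> (H \<union> K)" if "g' u v \<noteq> 0" for u v
  proof -
    have "g u v \<noteq> 0 \<or> h u v \<noteq> 0" using that by (auto simp: g'_def)
    then show ?thesis using g(2)[of u v] h(2)[of u v] by auto
  qed
  have "net V h v = net B h v" for v
    by (rule net_superset[OF finite_V BV]) (use h(2) in blast)
  then have even': "even (net V g' v)" for v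
    unfolding g'_def net_linear using g(3) h(3) by simp
  \<comment> \<open>The supports of \<open>g\<close> and \<open>h\<close> lie on disjoint vertex
    sets, so no two odd values cancel.\<close>
  have odd': "odd_arcs g' = odd_arcs g \<union> odd_arcs h"
  proof -
    have "g u v = 0 \<or> h u v = 0" for u v
      using g(2)[of u v] h(2)[of u v] KH by blast
    then have "odd (g' u v) \<longleftrightarrow> odd (g u v) \<or> odd (h u v)" for u v
      unfolding g'_def by (metis add.right_neutral add_0 even_zero mult_1)
    then show ?thesis by (auto simp: odd_arcs_def)
  qed
  have symU: "sym U\<^sub>1" "sym U\<^sub>2"
    using T(3,4) unfolding U\<^sub>1_def U\<^sub>2_def sym_def by blast+
  have sym': "sym (odd_arcs g' \<union> U\<^sub>1)" "sym (odd_arcs g' \<union> U\<^sub>2)"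
    using sym_odd_arcs[OF skew'] symU by (auto intro: sym_Un)
  have conK: "(x, v) \<in> (odd_arcs g' \<union> U)\<^sup>*" if "v \<in> K" for v U
    using h(4)[OF that] rtrancl_mono[of "odd_arcs h" "odd_arcs g' \<union> U"] odd' by blast
  have conH: "(u, v) \<in> (odd_arcs g' \<union> U\<^sub>1)\<^sup>*" "(u, v) \<in> (odd_arcs g' \<union> U\<^sub>2)\<^sup>*" if "u \<in> H" "v \<in> H" for u v
    using con[OF that] rtrancl_mono[of "odd_arcs g \<union> T\<^sub>1" "odd_arcs g' \<union> U\<^sub>1"]
      rtrancl_mono[of "odd_arcs g \<union> T\<^sub>2" "odd_arcs g' \<union> U\<^sub>2"] odd' U\<^sub>1_def U\<^sub>2_def by blast+
  have "(u, v) \<in> (odd_arcs g' \<union> U\<^sub>1)\<^sup>*" "(u, v) \<in> (odd_arcs g' \<union> U\<^sub>2)\<^sup>*"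
    if "u \<in> H \<union> K" "v \<in> H \<union> K" for u v
  proof -
    show "(u, v) \<in> (odd_arcs g' \<union> U\<^sub>1)\<^sup>*"
      by (rule connected_extend[OF sym'(1) conH(1) conK K(1) xa(3) _ that]) (auto simp: U\<^sub>1_def)
    show "(u, v) \<in> (odd_arcs g' \<union> U\<^sub>2)\<^sup>*"
      by (rule connected_extend[OF sym'(2) conH(2) conK K(2) yb(3) _ that]) (auto simp: U\<^sub>2_def)
  qed
  moreover have "U\<^sub>1 \<subseteq> A \<inter> (H \<union> K) \<times> (H \<union> K)" "U\<^sub>2 \<subseteq> A \<inter> (H \<union> K) \<times> (H \<union> K)"
    using T K xa yb A_flip by (auto simp: U\<^sub>1_def U\<^sub>2_def)
  moreover have "U\<^sub>1 \<inter> U\<^sub>2 = {}"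
    using T(1,2,5) xa yb ne BH by (auto simp: U\<^sub>1_def U\<^sub>2_def)
  ultimately have "double_tree (H \<union> K) g' U\<^sub>1 U\<^sub>2"
    unfolding double_tree_def using skew' supp' even' symU by blast
  moreover have "H \<subset> H \<union> K" "H \<union> K \<subseteq> V"
    using K KH H BV by auto
  ultimately show ?thesis by blast
qed

text \<open>A single vertex is a valid start, and a largest \<open>H\<close> must be
  \<open>V\<close>, since otherwise it could be extended.\<close>

lemma double_tree_exists:
  assumes cut3: "\<And>R. R \<subseteq> V \<Longrightarrow> R \<noteq> {} \<Longrightarrow> R \<noteq> V \<Longrightarrow> 3 \<le> card (A \<inter> R \<times> (V - R))" and "V \<noteq> {}"
  obtains g T\<^sub>1 T\<^sub>2 where "double_tree V g T\<^sub>1 T\<^sub>2"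
proof -
  define P where "P H \<longleftrightarrow> H \<subseteq> V \<and> H \<noteq> {} \<and> (\<exists>g T\<^sub>1 T\<^sub>2. double_tree H g T\<^sub>1 T\<^sub>2)" for H
  obtain x where "x \<in> V" using \<open>V \<noteq> {}\<close> by blast
  have "double_tree {x} (\<lambda>_ _. 0) {} {}"
    unfolding double_tree_def by (simp add: skew_zero net_def)
  then have "P {x}" using \<open>x \<in> V\<close> unfolding P_def by blast
  have "\<exists>H. P H \<and> (\<forall>H'. P H' \<longrightarrow> card H' \<le> card H)"
    by (rule ex_has_greatest_nat[of P "{x}" card "Suc (card V)"])
      (use \<open>P {x}\<close> card_mono[OF finite_V] in \<open>auto simp: P_def less_Suc_eq_le\<close>)
  then obtain H where H: "P H" and max: "\<And>H'. P H' \<Longrightarrow> card H' \<le> card H" by blast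
  have "H = V"
  proof (rule ccontr)
    assume "H \<noteq> V"
    obtain g T\<^sub>1 T\<^sub>2 where "H \<subseteq> V" "H \<noteq> {}" "double_tree H g T\<^sub>1 T\<^sub>2"
      using H unfolding P_def by blast
    from double_tree_extend[OF cut3 this(1,2) \<open>H \<noteq> V\<close> this(3)]
    obtain H' where "H \<subset> H'" "P H'"
      using \<open>H \<noteq> {}\<close> unfolding P_def by blast
    then have "card H < card H'"
      using finite_V by (intro psubset_card_mono) (auto simp: P_def intro: finite_subset)
    with max[OF \<open>P H'\<close>] show False by simp
  qed
  then show thesis using H that unfolding P_def by blast
qed

section \<open>Cotrees and the three covering circulations\<close>

text \<open>An arc outside \<open>T\<close> whose value is still even is repaired by adding a cycle
  that closes it through \<open>T\<close>. The cycle uses no other edge outside \<open>T\<close>, so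
  earlier repairs persist.\<close>

lemma cotree_circulation:
  assumes T: "T \<subseteq> A" "sym T" "\<And>u v. u \<in> V \<Longrightarrow> v \<in> V \<Longrightarrow> (u, v) \<in> T\<^sup>*"
  obtains f where "circulation V A f" "\<And>u v. (u, v) \<in> A - T \<Longrightarrow> odd (f u v)"
proof -
  have "\<exists>f. circulation V A f \<and> (\<forall>u v. (u, v) \<in> F \<longrightarrow> odd (f u v))" if "finite F" "F \<subseteq> A - T" for F
    using that
  proof (induction F rule: finite_induct)
    case empty
    have "circulation V A (\<lambda>_ _. 0)"
      by (simp add: circulation_def skew_zero net_def)
    then show ?case by blast
  next
    case (insert e F)
    obtain x y where e: "e = (x, y)" by (cases e)
    obtain f where f: "circulation V A f" "\<And>u v. (u, v) \<in> F \<Longrightarrow> odd (f u v)"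
      using insert.IH insert.prems by (elim exE conjE meta_impE) auto
    show ?case
    proof (cases "odd (f x y)")
      case True
      then show ?thesis using f e by (intro exI[of _ f]) auto
    next
      case False
      have xy: "(x, y) \<in> A" "(x, y) \<notin> T" "x \<in> V" "y \<in> V"
        using insert.prems e A_subset by auto
      have skf: "skew f" using f(1) by (simp add: circulation_def)
      have "(\<lambda>u v. (u, v) \<in> T)\<^sup>*\<^sup>* x y"
        using T(3)[OF xy(3,4)] by (simp add: rtranclp_rtrancl_eq)
      then obtain p where p: "skew p" "\<And>u v. \<bar>p u v\<bar> \<le> 1" "\<And>u v. p u v > 0 \<Longrightarrow> (u, v) \<in> T"
        "\<And>v. net V p v = of_bool (v = x) - of_bool (v = y)"
        using path_chain[of "\<lambda>u v. (u, v) \<in> T" x y V] finite_V T(1) A_subset by blast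
      have pT: "(u, v) \<in> T" if "p u v \<noteq> 0" for u v
      proof (cases "p u v > 0")
        case False
        then have "p v u > 0" using that skewD[OF p(1), of u v] by linarith
        then show ?thesis using p(3) T(2) by (meson symE)
      qed (rule p(3))
      define c where "c = (\<lambda>u v. 1 * unit_chain x y u v + (-1) * p u v)"
      have cA: "(u, v) \<in> A" if "c u v \<noteq> 0" for u v
      proof -
        have "(u, v) = (x, y) \<or> (u, v) = (y, x) \<or> p u v \<noteq> 0"
          using that unfolding c_def unit_chain_def by (auto split: if_splits)
        then show ?thesis using xy(1) A_flip pT T(1) by blast
      qed
      have c: "circulation V A c"
        unfolding circulation_def
      proof (intro conjI ballI allI impI)
        show "skew c"
          unfolding c_def by (intro skew_linear skew_unit_chain p)
        show "net V c v = 0" for v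
          unfolding c_def net_linear p(4) net_unit_chain[OF finite_V xy(3,4)] by simp
      qed (rule cA)
      define f' where "f' = (\<lambda>u v. 1 * f u v + 1 * c u v)"
      have "circulation V A f'"
        unfolding f'_def by (rule circulation_linear[OF f(1) c])
      moreover have "odd (f' u v)" if uv: "(u, v) \<in> insert e F" for u v
      proof -
        have p0: "p u v = 0" using pT[of u v] uv insert.prems e by blast
        show ?thesis
        proof (cases "(u, v) = (x, y)")
          case True
          have "x \<noteq> y" using xy(1) no_loop by blast
          then have "c u v = 1" using True p0 by (simp add: c_def unit_chain_def)
          then show ?thesis using True \<open>\<not> odd (f x y)\<close> by (simp add: f'_def)
        next
          case ne: False
          then have odd: "odd (f u v)" using uv f(2) e by blast
          \<comment> \<open>By skew symmetry the reverse arc cannot already be odd while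
            \<open>f x y\<close> is even, so the added cycle vanishes at
            \<open>(u, v)\<close>.\<close>
          then have "(u, v) \<noteq> (y, x)"
            using False skewD[OF skf, of x y] by auto
          then have "c u v = 0"
            using ne p0 by (auto simp: c_def unit_chain_def)
          then show ?thesis using odd by (simp add: f'_def)
        qed
      qed
      ultimately show ?thesis by blast
    qed
  qed
  from this[of "A - T"] obtain f where "circulation V A f" "\<forall>u v. (u, v) \<in> A - T \<longrightarrow> odd (f u v)"
    using finite_A by (elim exE conjE meta_impE) auto
  then show thesis using that[of f] by simp
qed

lemma circulation_parity:
  assumes "circulation V A f"
  obtains h where "circulation V A h" "\<And>u v. \<bar>h u v\<bar> \<le> 1" "\<And>u v. even (h u v) = even (f u v)"
  using circulation_of_even_net[OF finite_V _ _ A_subset, of f] assms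
  unfolding circulation_def by auto

text \<open>An arc that is not odd in \<open>g\<close> avoids one of the disjoint sets
  \<open>T\<^sub>1\<close>, \<open>T\<^sub>2\<close>, so it lies outside one of the two connected
  subgraphs and is covered by the circulation for that cotree.\<close>

lemma three_circulations:
  assumes "double_tree V g T\<^sub>1 T\<^sub>2"
  obtains f\<^sub>1 f\<^sub>2 f\<^sub>3 where "circulation V A f\<^sub>1" "circulation V A f\<^sub>2" "circulation V A f\<^sub>3"
    "\<And>u v. (u, v) \<in> A \<Longrightarrow> odd (f\<^sub>1 u v) \<or> odd (f\<^sub>2 u v) \<or> odd (f\<^sub>3 u v)"
proof -
  have g: "skew g" "\<And>u v. g u v \<noteq> 0 \<Longrightarrow> (u, v) \<in> A" "\<And>v. even (net V g v)"
    and T: "T\<^sub>1 \<subseteq> A" "T\<^sub>2 \<subseteq> A" "sym T\<^sub>1" "sym T\<^sub>2" "T\<^sub>1 \<inter> T\<^sub>2 = {}"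
    and con: "\<And>u v. u \<in> V \<Longrightarrow> v \<in> V \<Longrightarrow> (u, v) \<in> (odd_arcs g \<union> T\<^sub>1)\<^sup>*"
      "\<And>u v. u \<in> V \<Longrightarrow> v \<in> V \<Longrightarrow> (u, v) \<in> (odd_arcs g \<union> T\<^sub>2)\<^sup>*"
    using assms unfolding double_tree_def by blast+
  have "odd_arcs g \<subseteq> A"
    using g(2) unfolding odd_arcs_def by force
  obtain f\<^sub>1 where f1: "circulation V A f\<^sub>1" "\<And>u v. \<bar>f\<^sub>1 u v\<bar> \<le> 1"
    "\<And>u v. even (f\<^sub>1 u v) = even (g u v)"
    using circulation_of_even_net[OF finite_V g(1,2) A_subset g(3)] by auto
  obtain f\<^sub>2 where f2: "circulation V A f\<^sub>2" "\<And>u v. (u, v) \<in> A - (odd_arcs g \<union> T\<^sub>1) \<Longrightarrow> odd (f\<^sub>2 u v)"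
    using cotree_circulation[OF _ sym_Un[OF sym_odd_arcs[OF g(1)] T(3)] con(1)] \<open>odd_arcs g \<subseteq> A\<close> T(1)
    by auto
  obtain f\<^sub>3 where f3: "circulation V A f\<^sub>3" "\<And>u v. (u, v) \<in> A - (odd_arcs g \<union> T\<^sub>2) \<Longrightarrow> odd (f\<^sub>3 u v)"
    using cotree_circulation[OF _ sym_Un[OF sym_odd_arcs[OF g(1)] T(4)] con(2)] \<open>odd_arcs g \<subseteq> A\<close> T(2)
    by auto
  have "odd (f\<^sub>1 u v) \<or> odd (f\<^sub>2 u v) \<or> odd (f\<^sub>3 u v)" if "(u, v) \<in> A" for u v
  proof (cases "(u, v) \<in> odd_arcs g")
    case True
    then show ?thesis using f1(3) by (simp add: odd_arcs_def)
  next
    case False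
    then show ?thesis using f2(2)[of u v] f3(2)[of u v] that T(5) by blast
  qed
  then show thesis using that f1(1) f2(1) f3(1) by blast
qed

end

section \<open>Five nowhere-zero flows\<close>

text \<open>
  Here \<open>a, b, c\<close> are the values on one arc of three flows, and \<open>p, q, s\<close> those of flows on the mod-2
  sums of the first two, of the first and third, and of all three supports. The seven possible
  supports of \<open>(a, b, c)\<close> are treated as follows: \<open>100\<close>, \<open>010\<close>, \<open>001\<close>, \<open>101\<close>, \<open>111\<close> are served by
  flow number 1, 2, 3, 4, 5 respectively; on \<open>110\<close> one of the first two flows is \<open>\<plusminus>1\<close>, according to
  the sign of \<open>a b\<close>, and on \<open>011\<close> one of the third and fourth, according to the sign of \<open>b c\<close>.
\<close>

lemma five_combinations:
  fixes a b c p q s :: int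
  assumes "\<bar>a\<bar> \<le> 1" "\<bar>b\<bar> \<le> 1" "\<bar>c\<bar> \<le> 1" "\<bar>p\<bar> \<le> 1" "\<bar>q\<bar> \<le> 1" "\<bar>s\<bar> \<le> 1"
    and "even p = even (a + b)" "even q = even (a + c)" "even s = even (a + b + c)"
    and "odd a \<or> odd b \<or> odd c"
  shows "a + 2 * b + 4 * c \<noteq> 0" "2 * a - b + 4 * c \<noteq> 0" "4 * a + 2 * b + c \<noteq> 0"
    "c - 2 * b + 4 * s \<noteq> 0" "a + 2 * p + 4 * q \<noteq> 0"
    "\<bar>a + 2 * b + 4 * c\<bar> = 1 \<or> \<bar>2 * a - b + 4 * c\<bar> = 1 \<or> \<bar>4 * a + 2 * b + c\<bar> = 1 \<or>
     \<bar>c - 2 * b + 4 * s\<bar> = 1 \<or> \<bar>a + 2 * p + 4 * q\<bar> = 1"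
proof -
  have *: "x = -1 \<or> x = 0 \<or> x = 1" if "\<bar>x\<bar> \<le> 1" for x :: int
    using that by linarith
  note abc = *[OF assms(1)] *[OF assms(2)] *[OF assms(3)]
  note pqs = *[OF assms(4)] *[OF assms(5)] *[OF assms(6)]
  \<comment> \<open>With coefficients 1, 2, 4 up to sign, values in -1, 0, 1 cancel only if all
    three vanish. For the last two combinations, the parities of \<open>s\<close>, or of
    \<open>p\<close> and \<open>q\<close>, then make \<open>a\<close>, \<open>b\<close>,
    \<open>c\<close> all even.\<close>
  show "a + 2 * b + 4 * c \<noteq> 0" "2 * a - b + 4 * c \<noteq> 0" "4 * a + 2 * b + c \<noteq> 0"
    using abc assms(10) by auto
  show "c - 2 * b + 4 * s \<noteq> 0"
    using abc assms(9,10) pqs(3) by auto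
  show "a + 2 * p + 4 * q \<noteq> 0"
    using abc assms(7,8,10) pqs(1,2) by auto
  show "\<bar>a + 2 * b + 4 * c\<bar> = 1 \<or> \<bar>2 * a - b + 4 * c\<bar> = 1 \<or> \<bar>4 * a + 2 * b + c\<bar> = 1 \<or>
     \<bar>c - 2 * b + 4 * s\<bar> = 1 \<or> \<bar>a + 2 * p + 4 * q\<bar> = 1"
    using abc
  proof (elim disjE)
  qed (use pqs assms(7-10) in auto)
qed

context sym_arcs
begin

lemma five_flows:
  assumes cut3: "\<And>R. R \<subseteq> V \<Longrightarrow> R \<noteq> {} \<Longrightarrow> R \<noteq> V \<Longrightarrow> 3 \<le> card (A \<inter> R \<times> (V - R))" and "V \<noteq> {}"
  obtains F :: "nat \<Rightarrow> 'a \<Rightarrow> 'a \<Rightarrow> int"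
  where "\<And>i. i \<in> {1..5} \<Longrightarrow> circulation V A (F i)"
    "\<And>i u v. i \<in> {1..5} \<Longrightarrow> (u, v) \<in> A \<Longrightarrow> F i u v \<noteq> 0"
    "\<And>u v. (u, v) \<in> A \<Longrightarrow> \<exists>i\<in>{1..5}. \<bar>F i u v\<bar> = 1"
proof -
  obtain g T\<^sub>1 T\<^sub>2 where dt: "double_tree V g T\<^sub>1 T\<^sub>2"
    using double_tree_exists[OF cut3 \<open>V \<noteq> {}\<close>] by blast
  obtain f\<^sub>1 f\<^sub>2 f\<^sub>3 where f: "circulation V A f\<^sub>1" "circulation V A f\<^sub>2" "circulation V A f\<^sub>3"
    and odd: "\<And>u v. (u, v) \<in> A \<Longrightarrow> odd (f\<^sub>1 u v) \<or> odd (f\<^sub>2 u v) \<or> odd (f\<^sub>3 u v)"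
    using three_circulations[OF dt] by blast
  obtain a where a: "circulation V A a" "\<And>u v. \<bar>a u v\<bar> \<le> 1" "\<And>u v. even (a u v) = even (f\<^sub>1 u v)"
    using circulation_parity[OF f(1)] by auto
  obtain b where b: "circulation V A b" "\<And>u v. \<bar>b u v\<bar> \<le> 1" "\<And>u v. even (b u v) = even (f\<^sub>2 u v)"
    using circulation_parity[OF f(2)] by auto
  obtain c where c: "circulation V A c" "\<And>u v. \<bar>c u v\<bar> \<le> 1" "\<And>u v. even (c u v) = even (f\<^sub>3 u v)"
    using circulation_parity[OF f(3)] by auto
  \<comment> \<open>These sums are odd exactly on the mod-2 sums of the supports. The flows
    \<open>p\<close>, \<open>q\<close>, \<open>s\<close> obtained from them agree with them in
    parity only, their values being reduced again.\<close>
  note ab = circulation_linear[OF a(1) b(1), of 1 1]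
  note ac = circulation_linear[OF a(1) c(1), of 1 1]
  note abc = circulation_linear[OF ab c(1), of 1 1]
  obtain p where p: "circulation V A p" "\<And>u v. \<bar>p u v\<bar> \<le> 1"
    "\<And>u v. even (p u v) = even (1 * a u v + 1 * b u v)"
    using circulation_parity[OF ab] by auto
  obtain q where q: "circulation V A q" "\<And>u v. \<bar>q u v\<bar> \<le> 1"
    "\<And>u v. even (q u v) = even (1 * a u v + 1 * c u v)"
    using circulation_parity[OF ac] by auto
  obtain s where s: "circulation V A s" "\<And>u v. \<bar>s u v\<bar> \<le> 1"
    "\<And>u v. even (s u v) = even (1 * (1 * a u v + 1 * b u v) + 1 * c u v)"
    using circulation_parity[OF abc] by auto
  define F :: "nat \<Rightarrow> 'a \<Rightarrow> 'a \<Rightarrow> int" where "F i u v =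
    (if i = 1 then a u v + 2 * b u v + 4 * c u v
     else if i = 2 then 2 * a u v - b u v + 4 * c u v
     else if i = 3 then 4 * a u v + 2 * b u v + c u v
     else if i = 4 then c u v - 2 * b u v + 4 * s u v
     else a u v + 2 * p u v + 4 * q u v)" for i u v
  have range: "i = 1 \<or> i = 2 \<or> i = 3 \<or> i = 4 \<or> i = 5" if "i \<in> {1..5}" for i :: nat
    using that by auto
  have lin: "circulation V A (\<lambda>u v. k * f u v + l * g u v + m * h u v)"
    if "circulation V A f" "circulation V A g" "circulation V A h" for f g h k l m
    using circulation_linear[OF circulation_linear[OF that(1,2), of k l] that(3), of 1 m] by simp
  have circ: "circulation V A (F i)" if "i \<in> {1..5}" for i
    using range[OF that] lin[OF a(1) b(1) c(1), of 1 2 4] lin[OF a(1) b(1) c(1), of 2 "-1" 4]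
      lin[OF a(1) b(1) c(1), of 4 2 1] lin[OF c(1) b(1) s(1), of 1 "-2" 4] lin[OF a(1) p(1) q(1), of 1 2 4]
    unfolding F_def by (elim disjE) simp_all
  have arc: "a u v + 2 * b u v + 4 * c u v \<noteq> 0" "2 * a u v - b u v + 4 * c u v \<noteq> 0"
    "4 * a u v + 2 * b u v + c u v \<noteq> 0" "c u v - 2 * b u v + 4 * s u v \<noteq> 0"
    "a u v + 2 * p u v + 4 * q u v \<noteq> 0"
    "\<bar>F 1 u v\<bar> = 1 \<or> \<bar>F 2 u v\<bar> = 1 \<or> \<bar>F 3 u v\<bar> = 1 \<or> \<bar>F 4 u v\<bar> = 1 \<or> \<bar>F 5 u v\<bar> = 1"
    if "(u, v) \<in> A" for u v
  proof -
    note * = a(2)[of u v] b(2)[of u v] c(2)[of u v] p(2)[of u v] q(2)[of u v] s(2)[of u v]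
      p(3)[of u v, simplified mult_1] q(3)[of u v, simplified mult_1] s(3)[of u v, simplified mult_1]
    have o: "odd (a u v) \<or> odd (b u v) \<or> odd (c u v)"
      using odd[OF that] a(3) b(3) c(3) by simp
    note five = five_combinations[OF * o]
    show "a u v + 2 * b u v + 4 * c u v \<noteq> 0" "2 * a u v - b u v + 4 * c u v \<noteq> 0"
      "4 * a u v + 2 * b u v + c u v \<noteq> 0" "c u v - 2 * b u v + 4 * s u v \<noteq> 0"
      "a u v + 2 * p u v + 4 * q u v \<noteq> 0"
      by (fact five)+
    show "\<bar>F 1 u v\<bar> = 1 \<or> \<bar>F 2 u v\<bar> = 1 \<or> \<bar>F 3 u v\<bar> = 1 \<or> \<bar>F 4 u v\<bar> = 1 \<or> \<bar>F 5 u v\<bar> = 1"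
      using five(6) by (simp add: F_def)
  qed
  show thesis
  proof (rule that[of F])
    show "F i u v \<noteq> 0" if "i \<in> {1..5}" "(u, v) \<in> A" for i u v
      using range[OF that(1)] arc(1-5)[OF that(2)] by (simp add: F_def)
    show "\<exists>i\<in>{1..5}. \<bar>F i u v\<bar> = 1" if "(u, v) \<in> A" for u v
      using arc(6)[OF that] by (elim disjE) (rule bexI, assumption, simp)+
  qed (rule circ)
qed

text \<open>
  An arc of value 1 cannot be the only arc leaving a set \<open>R\<close>: then only one unit would enter \<open>R\<close>,
  so the cut would have at most two edges.
\<close>

lemma positive_arcs_connected:
  assumes cut3: "\<And>R. R \<subseteq> V \<Longrightarrow> R \<noteq> {} \<Longrightarrow> R \<noteq> V \<Longrightarrow> 3 \<le> card (A \<inter> R \<times> (V - R))"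
    and f: "circulation V A f" "\<And>u v. (u, v) \<in> A \<Longrightarrow> f u v \<noteq> 0" and ab: "f a b \<le> 1"
    and xy: "x \<in> V" "y \<in> V"
  shows "(x, y) \<in> ({(u, v). f u v > 0} - {(a, b)})\<^sup>*"
proof (rule ccontr)
  define Q where "Q = {(u, v). f u v > 0} - {(a, b)}"
  define R where "R = {v \<in> V. (x, v) \<in> Q\<^sup>*}"
  define C where "C = A \<inter> R \<times> (V - R)"
  assume "\<not> ?thesis"
  then have R: "R \<subseteq> V" "R \<noteq> {}" "R \<noteq> V"
    using xy by (auto simp: R_def Q_def)
  have C: "3 \<le> card C" "finite C"
    using cut3[OF R] finite_A by (simp_all add: C_def)
  \<comment> \<open>Among the arcs leaving \<open>R\<close> only \<open>(a, b)\<close> can be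
    positive, with value at most 1 = 2 - 1; all others are at most -1. The total is at most
    \<open>2 - card C\<close>, hence negative, whereas a circulation has total 0.\<close>
  have bound: "f u v \<le> (if (u, v) = (a, b) then 2 else 0) - 1" if "(u, v) \<in> C" for u v
  proof -
    have "(u, v) \<notin> Q"
    proof
      assume "(u, v) \<in> Q"
      moreover have "(x, u) \<in> Q\<^sup>*" using that by (simp add: C_def R_def)
      ultimately have "(x, v) \<in> Q\<^sup>*" by (rule rtrancl_into_rtrancl[rotated])
      then show False using that by (simp add: C_def R_def)
    qed
    then have "(u, v) = (a, b) \<or> \<not> f u v > 0"
      unfolding Q_def by blast
    moreover have "f u v \<noteq> 0"
      using that by (intro f(2)) (simp add: C_def)
    ultimately show ?thesis
    proof (elim disjE)
      assume "(u, v) = (a, b)"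
      then show ?thesis using ab by simp
    next
      assume "\<not> f u v > 0"
      then have "f u v \<le> - 1" using \<open>f u v \<noteq> 0\<close> by linarith
      then show ?thesis using ab by simp
    qed
  qed
  have "(\<Sum>(u, v)\<in>C. f u v) \<le> (\<Sum>e\<in>C. (if e = (a, b) then 2 else 0) - 1)"
  proof (rule sum_mono)
    show "(case e of (u, v) \<Rightarrow> f u v) \<le> (if e = (a, b) then 2 else 0) - 1" if "e \<in> C" for e
      using bound[of "fst e" "snd e"] that by (simp only: case_prod_beta prod.collapse)
  qed
  also have "\<dots> \<le> 2 - int (card C)"
    using C(2) by (simp add: sum_subtractf)
  finally have "(\<Sum>(u, v)\<in>C. f u v) < 0" using C(1) by linarith
  moreover have "(\<Sum>v\<in>R. net V f v) = (\<Sum>(u, v)\<in>C. f u v)"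
    unfolding C_def by (rule sum_net_restrict[OF finite_V _ R(1)]) (use f(1) in \<open>auto simp: circulation_def\<close>)
  moreover have "(\<Sum>v\<in>R. net V f v) = 0"
    using f(1) R(1) by (intro sum.neutral) (auto simp: circulation_def)
  ultimately show False by simp
qed

end

section \<open>The Frank number\<close>

text \<open>Reachability in a digraph confines walks to the vertex set; as arcs stay inside it, the
  plain closure suffices.\<close>

lemma strongly_connectedI_rtrancl:
  assumes "verts D \<noteq> {}" "arcs_ends D \<subseteq> verts D \<times> verts D"
    and "\<And>u v. u \<in> verts D \<Longrightarrow> v \<in> verts D \<Longrightarrow> (u, v) \<in> (arcs_ends D)\<^sup>*"
  shows "strongly_connected D"
  unfolding strongly_connected_def reachable_def
proof (intro conjI ballI)
  fix u v assume "u \<in> verts D" "v \<in> verts D"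
  from assms(3)[OF this] show "(u, v) \<in> rtrancl_on (verts D) (arcs_ends D)"
  proof (induction rule: rtrancl_induct)
    case base
    then show ?case using \<open>u \<in> verts D\<close> by simp
  next
    case (step v w)
    then show ?case using assms(2) by (blast intro: rtrancl_on_into_rtrancl_on)
  qed
qed (rule assms(1))

text \<open>Deleting the edges of the cut leaves no way out of \<open>R\<close>. Passing from arcs
  to edges cannot raise the count, which is the direction needed.\<close>

lemma k_edge_connected_cut:
  assumes "pair_graph G" "k_edge_connected k G" "R \<subseteq> pverts G" "R \<noteq> {}" "R \<noteq> pverts G"
  shows "k \<le> card (parcs G \<inter> R \<times> (pverts G - R))"
proof (rule ccontr)
  interpret pair_graph G by fact
  define C where "C = parcs G \<inter> R \<times> (pverts G - R)"
  assume "\<not> ?thesis"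
  moreover have "finite C"
    using pair_finite_arcs by (simp add: C_def)
  ultimately have "card (ends ` C) < k"
    using card_image_le[of C ends] by (simp add: C_def)
  moreover have "ends ` C \<subseteq> edges G"
    unfolding edges_def C_def by blast
  ultimately have "connected (with_proj (del_edges G (ends ` C)))"
    using assms(2) by (simp add: k_edge_connected_def)
  then have sc: "strongly_connected (with_proj (mk_symmetric (with_proj (del_edges G (ends ` C)))))"
    (is "strongly_connected (with_proj ?M)")
    by (simp add: connected_def)
  obtain x y where x: "x \<in> R" "x \<in> pverts G" and y: "y \<in> pverts G" "y \<notin> R"
    using assms(3-5) by blast
  have "(x, y) \<in> rtrancl_on (pverts G) (parcs ?M)"
    using sc x y unfolding strongly_connected_def reachable_def
    by (simp add: mk_symmetric_def del_edges_def)
  then have "y \<in> R"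
  proof (induction rule: rtrancl_on_induct)
    case (step u v)
    \<comment> \<open>\<open>mk_symmetric\<close> may reverse an arc, which changes neither its
      \<open>ends\<close> nor its membership in the symmetric set \<open>parcs G\<close>.\<close>
    have "(u, v) \<in> parcs G" "ends (u, v) \<notin> ends ` C"
      using step.hyps pair_sym_arcs
      by (auto simp: mk_symmetric_def del_edges_def ends_def insert_commute symmetric_def dest: symD)
    then have "(u, v) \<notin> C" by blast
    then show ?case using \<open>(u, v) \<in> parcs G\<close> step by (auto simp: C_def)
  qed (rule x(1))
  with y show False by blast
qed

theorem theorem3:
  fixes G :: "'a pair_pre_digraph"
  assumes "pair_graph G"
    and "k_edge_connected 3 G"
  shows "frank_number G \<le> 5 \<and>
    (\<exists>D :: nat \<Rightarrow> 'a pair_pre_digraph.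
      (\<forall>i \<in> {1..5}. orientation G (D i) \<and> strongly_connected (with_proj (D i))) \<and>
      (\<forall>e \<in> edges G. \<exists>i \<in> {1..5}. \<exists>a \<in> parcs (D i). ends a = e \<and> deletable (D i) a))"
proof -
  interpret pair_graph G by fact
  have flip: "(v, u) \<in> parcs G" if "(u, v) \<in> parcs G" for u v
    using pair_sym_arcs that by (auto simp: symmetric_def dest: symD)
  interpret S: sym_arcs "pverts G" "parcs G"
  proof
    show "parcs G \<subseteq> pverts G \<times> pverts G"
      using arc_fst_in_verts arc_snd_in_verts by fastforce
    show "(v, v) \<notin> parcs G" for v
      using pair_no_loops[of "(v, v)"] by auto
  qed (use pair_finite_verts flip in \<open>auto intro: symI\<close>)
  note cut3 = k_edge_connected_cut[OF assms]
  \<comment> \<open>The cut condition is vacuous for the null graph, so a vertex is obtained from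
    connectedness with no edge deleted.\<close>
  have "connected (with_proj (del_edges G {}))"
    using assms(2) by (simp add: k_edge_connected_def)
  then have ne: "pverts G \<noteq> {}"
    by (simp add: connected_def strongly_connected_def mk_symmetric_def del_edges_def)
  obtain F :: "nat \<Rightarrow> 'a \<Rightarrow> 'a \<Rightarrow> int"
    where F: "\<And>i. i \<in> {1..5} \<Longrightarrow> circulation (pverts G) (parcs G) (F i)"
      "\<And>i u v. i \<in> {1..5} \<Longrightarrow> (u, v) \<in> parcs G \<Longrightarrow> F i u v \<noteq> 0"
      "\<And>u v. (u, v) \<in> parcs G \<Longrightarrow> \<exists>i\<in>{1..5}. \<bar>F i u v\<bar> = 1"
    using S.five_flows[OF cut3 ne] by blast
  define D where "D i = \<lparr>pverts = pverts G, parcs = {(u, v). F i u v > 0}\<rparr>" for i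
  have sub: "parcs (D i) \<subseteq> parcs G" if "i \<in> {1..5}" for i
    using F(1)[OF that] by (auto simp: D_def circulation_def)
  have skew: "F i u v = - F i v u" if "i \<in> {1..5}" for i u v
    by (rule skewD) (use F(1)[OF that] in \<open>simp add: circulation_def\<close>)
  have con: "(x, y) \<in> (parcs (D i) - {(a, b)})\<^sup>*"
    if "i \<in> {1..5}" "F i a b \<le> 1" "x \<in> pverts G" "y \<in> pverts G" for i a b x y
    using S.positive_arcs_connected[OF cut3 F(1)[OF that(1)] F(2)[OF that(1)] that(2-4)]
    by (simp add: D_def)
  have ori: "orientation G (D i)" if "i \<in> {1..5}" for i
    unfolding orientation_def
  proof (intro conjI allI impI sub[OF that])
    fix u v assume "(u, v) \<in> parcs G"
    then show "((u, v) \<in> parcs (D i)) \<noteq> ((v, u) \<in> parcs (D i))"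
      using F(2)[OF that, of u v] skew[OF that, of u v] by (auto simp: D_def)
  qed (simp add: D_def)
  have str: "strongly_connected (with_proj (D i))" if "i \<in> {1..5}" for i
  proof (rule strongly_connectedI_rtrancl)
    fix x y assume "x \<in> verts (with_proj (D i))" "y \<in> verts (with_proj (D i))"
    \<comment> \<open>The pair \<open>(x, x)\<close> has value 0 and is no arc, so removing it
      yields plain strong connectivity.\<close>
    then have "(x, y) \<in> (parcs (D i) - {(x, x)})\<^sup>*"
      using con[OF that, of x x x y] skew[OF that, of x x] by (simp add: D_def)
    then show "(x, y) \<in> (arcs_ends (with_proj (D i)))\<^sup>*"
      using rtrancl_mono[of "parcs (D i) - {(x, x)}" "parcs (D i)"] by auto
  qed (use ne sub[OF that] S.A_subset in \<open>auto simp: D_def\<close>)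
  have del: "deletable (D i) (u, v)" if i: "i \<in> {1..5}" and uv: "F i u v = 1" for i u v
    unfolding deletable_def
  proof
    show "(u, v) \<in> parcs (D i)" using uv by (simp add: D_def)
    have ends: "arcs_ends (pre_digraph.del_arc (with_proj (D i)) (u, v)) = parcs (D i) - {(u, v)}"
      by (auto simp: arcs_ends_conv pre_digraph.del_arc_def)
    have verts: "verts (pre_digraph.del_arc (with_proj (D i)) (u, v)) = pverts G"
      by (simp add: pre_digraph.del_arc_def D_def)
    show "strongly_connected (pre_digraph.del_arc (with_proj (D i)) (u, v))"
      by (rule strongly_connectedI_rtrancl; unfold ends verts)
        (use ne sub[OF i] S.A_subset con[OF i, of u v] uv in auto)
  qed
  have "\<exists>i\<in>{1..5}. \<exists>a\<in>parcs (D i). ends a = e \<and> deletable (D i) a" if e: "e \<in> edges G" for e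
  proof -
    obtain u v where uv: "(u, v) \<in> parcs G" "e = ends (u, v)"
      using e unfolding edges_def by (metis imageE surj_pair)
    then obtain i where i: "i \<in> {1..5}" "\<bar>F i u v\<bar> = 1" using F(3) by blast
    \<comment> \<open>Whichever direction is positive has value 1, and that is the arc chosen in
      \<open>D i\<close>.\<close>
    then have "F i u v = 1 \<or> F i v u = 1" using skew[OF i(1), of u v] by linarith
    then obtain a where "ends a = e" "deletable (D i) a"
      using del[OF i(1)] uv(2) by (metis ends_def fst_conv insert_commute snd_conv)
    then show ?thesis using i(1) by (auto simp: deletable_def)
  qed
  then have fam: "(\<forall>i \<in> {1..5}. orientation G (D i) \<and> strongly_connected (with_proj (D i))) \<and>
      (\<forall>e \<in> edges G. \<exists>i \<in> {1..5}. \<exists>a \<in> parcs (D i). ends a = e \<and> deletable (D i) a)"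
    using ori str by blast
  have "frank_number G \<le> enat 5"
    unfolding frank_number_def using fam by (intro Inf_lower) blast
  then show ?thesis
    using fam by (auto simp: numeral_eq_enat)
qed

end
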